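(* Let $\{b_\mu\}_{\mu\in\Lambda}$ be a family of nonzero rational functions on $\mathbb C\Lambda=\Lambda\otimes_{\mathbb Z}\mathbb C$ satisfying $$b_\mu(\lambda)\,b_\nu(\lambda+\mu)=b_{\mu+\nu}(\lambda)\qquad\text{for all }\mu,\nu\in\Lambda,$$ and such that $b_\mu$ is a polynomial for every $\mu\in\Omega$. Then for every $\mu\in\Omega$, $b_\mu$ can be expressed as a finite product $b_\mu(\lambda)=\prod_i(\alpha_i(\lambda)+k_i)$ with $\alpha_i\in\mathrm{Hom}(\Lambda,\mathbb Z)$ and $k_i\in\mathbb C$.
   Context: $\Lambda$ is a free abelian group of finite rank and $\Omega\subset\Lambda$ is a finitely generated submonoid which generates $\Lambda$ as a group. An element $\alpha\in\mathrm{Hom}(\Lambda,\mathbb Z)$ is extended linearly to $\mathbb C\Lambda$; $\alpha_i=0$ is allowed, so nonzero constants may appear as factors. *)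

theory Defs
  imports
    Complex_Main
    "HOL-Computational_Algebra.Polynomial"
    "HOL-Computational_Algebra.Fraction_Field"
    "HOL-Computational_Algebra.Group_Closure"
begin

class complex_space = ab_group_add +
  fixes scaleC :: "complex \<Rightarrow> 'a \<Rightarrow> 'a"  (infixr \<open>*\<^sub>C\<close> 75)
  assumes scaleC_add_right: "a *\<^sub>C (x + y) = a *\<^sub>C x + a *\<^sub>C y"
    and scaleC_add_left: "(a + b) *\<^sub>C x = a *\<^sub>C x + b *\<^sub>C x"
    and scaleC_scaleC: "a *\<^sub>C b *\<^sub>C x = (a * b) *\<^sub>C x"
    and scaleC_one: "1 *\<^sub>C x = x"

lemma vector_space_scaleC: "vector_space (scaleC :: complex \<Rightarrow> 'a \<Rightarrow> 'a::complex_space)"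
  by unfold_locales
    (simp_all add: scaleC_add_right scaleC_add_left scaleC_scaleC scaleC_one)

abbreviation linear_functional :: "('a::complex_space \<Rightarrow> complex) \<Rightarrow> bool" where
  "linear_functional \<equiv> Vector_Spaces.linear scaleC (*)"

(* A free abelian group of finite rank together with its complexification is modelled as a
   pair (L, UNIV), where L is the integer span of a finite complex basis B of the ambient space
   (so that the canonical map from the tensor product of L with the complex numbers to the
   ambient space is an isomorphism). B may be empty, i.e. rank 0 is included. *)
definition lattice :: "'a::complex_space set \<Rightarrow> bool" where
  "lattice L \<longleftrightarrow> (\<exists>B. finite_dimensional_vector_space scaleC B \<and> L = group_closure B)"

inductive_set monoid_closure :: "'a::comm_monoid_add set \<Rightarrow> 'a set" for S where
  zero: "0 \<in> monoid_closure S"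
| base: "s \<in> S \<Longrightarrow> s \<in> monoid_closure S"
| add: "s \<in> monoid_closure S \<Longrightarrow> t \<in> monoid_closure S \<Longrightarrow> s + t \<in> monoid_closure S"

definition fin_gen_submonoid :: "'a::comm_monoid_add set \<Rightarrow> bool" where
  "fin_gen_submonoid M \<longleftrightarrow> (\<exists>S. finite S \<and> M = monoid_closure S)"

(* The extensions to the complexification of the elements of Hom(L, Z). *)
definition integral_functionals :: "'a::complex_space set \<Rightarrow> ('a \<Rightarrow> complex) set" where
  "integral_functionals L = {f. linear_functional f \<and>
     (\<exists>a :: 'a \<Rightarrow> int. (\<forall>x\<in>L. \<forall>y\<in>L. a (x + y) = a x + a y) \<and> (\<forall>x\<in>L. f x = of_int (a x)))}"

(* As the complex numbers are infinite, polynomials on a complex vector space are the same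
   as polynomial functions. *)
inductive polynomial_fun :: "('a::complex_space \<Rightarrow> complex) \<Rightarrow> bool" where
  const: "polynomial_fun (\<lambda>x. c)"
| linear: "linear_functional f \<Longrightarrow> polynomial_fun f"
| add: "polynomial_fun f \<Longrightarrow> polynomial_fun g \<Longrightarrow> polynomial_fun (\<lambda>x. f x + g x)"
| mult: "polynomial_fun f \<Longrightarrow> polynomial_fun g \<Longrightarrow> polynomial_fun (\<lambda>x. f x * g x)"

lemma linear_functional_add: "linear_functional f \<Longrightarrow> f (x + y) = f x + f y"
  and linear_functional_scale: "linear_functional f \<Longrightarrow> f (c *\<^sub>C x) = c * f x"
  by (simp_all add: Vector_Spaces.linear_iff)

lemma polynomial_fun_shift:
  assumes "polynomial_fun f"
  shows "polynomial_fun (\<lambda>x. f (x + m))"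
  using assms
proof induction
  case (linear f)
  have "(\<lambda>x. f (x + m)) = (\<lambda>x. f x + f m)"
    by (simp add: linear_functional_add[OF linear])
  then show ?case
    by (simp add: polynomial_fun.intros linear)
qed (auto intro: polynomial_fun.intros)

lemma polynomial_fun_on_line:
  assumes "polynomial_fun f"
  shows "\<exists>p. \<forall>t. f (x + t *\<^sub>C y) = poly p t"
  using assms
proof induction
  case (const c)
  show ?case by (rule exI[of _ "[:c:]"]) simp
next
  case (linear f)
  show ?case
    by (rule exI[of _ "[:f x, f y:]"])
      (simp add: linear_functional_add[OF linear] linear_functional_scale[OF linear])
next
  case (add f g)
  then obtain p q where "\<forall>t. f (x + t *\<^sub>C y) = poly p t" "\<forall>t. g (x + t *\<^sub>C y) = poly q t"
    by blast
  then show ?case by (intro exI[of _ "p + q"]) simp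
next
  case (mult f g)
  then obtain p q where "\<forall>t. f (x + t *\<^sub>C y) = poly p t" "\<forall>t. g (x + t *\<^sub>C y) = poly q t"
    by blast
  then show ?case by (intro exI[of _ "p * q"]) simp
qed

lemma polynomial_fun_no_zero_divisors:
  assumes f: "polynomial_fun f" and g: "polynomial_fun g"
    and "f x \<noteq> 0" and "g y \<noteq> 0"
  shows "\<exists>z. f z * g z \<noteq> 0"
proof -
  obtain p where p: "\<And>t. f (x + t *\<^sub>C (y - x)) = poly p t"
    using polynomial_fun_on_line[OF f] by blast
  obtain q where q: "\<And>t. g (x + t *\<^sub>C (y - x)) = poly q t"
    using polynomial_fun_on_line[OF g] by blast
  have zero: "0 *\<^sub>C (y - x) = 0"
    using scaleC_add_left[of 0 0 "y - x"] by simp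
  have "poly p 0 \<noteq> 0" using p[of 0] \<open>f x \<noteq> 0\<close> by (simp add: zero)
  moreover have "poly q 1 \<noteq> 0" using q[of 1] \<open>g y \<noteq> 0\<close> by (simp add: scaleC_one)
  ultimately have "p * q \<noteq> 0" by auto
  then obtain t where "poly (p * q) t \<noteq> 0"
    using poly_all_0_iff_0 by blast
  then show ?thesis
    using p q by (metis poly_mult)
qed

typedef (overloaded) 'a polynomial = "{f :: 'a::complex_space \<Rightarrow> complex. polynomial_fun f}"
  morphisms eval Polynomial
  by (auto intro: polynomial_fun.const)

setup_lifting type_definition_polynomial

instantiation polynomial :: (complex_space) idom
begin

lift_definition zero_polynomial :: "'a polynomial" is "\<lambda>x. 0"
  by (rule polynomial_fun.const)

lift_definition one_polynomial :: "'a polynomial" is "\<lambda>x. 1"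
  by (rule polynomial_fun.const)

lift_definition plus_polynomial :: "'a polynomial \<Rightarrow> 'a polynomial \<Rightarrow> 'a polynomial"
  is "\<lambda>f g x. f x + g x"
  by (rule polynomial_fun.add)

lift_definition times_polynomial :: "'a polynomial \<Rightarrow> 'a polynomial \<Rightarrow> 'a polynomial"
  is "\<lambda>f g x. f x * g x"
  by (rule polynomial_fun.mult)

lift_definition uminus_polynomial :: "'a polynomial \<Rightarrow> 'a polynomial" is "\<lambda>f x. - f x"
  using polynomial_fun.mult[OF polynomial_fun.const[of "-1"]] by simp

lift_definition minus_polynomial :: "'a polynomial \<Rightarrow> 'a polynomial \<Rightarrow> 'a polynomial"
  is "\<lambda>f g x. f x - g x"
  using polynomial_fun.add[OF _ polynomial_fun.mult[OF polynomial_fun.const[of "-1"]]]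
  by fastforce

instance
proof
  fix a b :: "'a polynomial"
  show "a \<noteq> 0 \<Longrightarrow> b \<noteq> 0 \<Longrightarrow> a * b \<noteq> 0"
    by transfer (metis polynomial_fun_no_zero_divisors)
qed (transfer; auto simp: algebra_simps fun_eq_iff)+

end

lift_definition shift_polynomial :: "'a::complex_space \<Rightarrow> 'a polynomial \<Rightarrow> 'a polynomial"
  is "\<lambda>m f x. f (x + m)"
  by (rule polynomial_fun_shift)

lemma shift_polynomial_mult:
  "shift_polynomial m (p * q) = shift_polynomial m p * shift_polynomial m q"
  by transfer simp

lemma shift_polynomial_eq_0_iff: "shift_polynomial m p = 0 \<longleftrightarrow> p = 0"
  by transfer (auto simp: fun_eq_iff, metis diff_add_cancel)

lemma shift_polynomial_0: "shift_polynomial m 0 = 0"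
  and shift_polynomial_1: "shift_polynomial m 1 = 1"
  by (transfer, simp)+

type_synonym 'a rational_function = "'a polynomial fract"

lift_definition shift :: "'a::complex_space \<Rightarrow> 'a rational_function \<Rightarrow> 'a rational_function"
  is "\<lambda>m (p, q). (shift_polynomial m p, shift_polynomial m q)"
  by (auto simp: shift_polynomial_eq_0_iff simp flip: shift_polynomial_mult)

lemma shift_Fract:
  "shift m (Fraction_Field.Fract p q) =
     Fraction_Field.Fract (shift_polynomial m p) (shift_polynomial m q)"
  by transfer (simp add: shift_polynomial_eq_0_iff shift_polynomial_0 shift_polynomial_1)

definition rational_of_polynomial :: "'a::complex_space polynomial \<Rightarrow> 'a rational_function" where
  "rational_of_polynomial p = Fraction_Field.Fract p 1"

end

(* Write B for the polynomials b on \<Omega>. Fix a direction e and expand polynomials along e, as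
   elements of K[t] for the field K of rational functions. An irreducible factor P of B \<mu> in K[t]
   gives the prime ideal I of all polynomials divisible by P in K[t], and as K[t] is factorial, only
   finitely many translates of I (up to the stabilizer of I) contain a given nonzero polynomial.
   The cocycle identity B \<kappa> (x) B \<nu> (x + \<kappa>) = B \<nu> (x) B \<kappa> (x + \<nu>) moves a translate of I containing
   B \<kappa> along \<nu> until it contains B \<nu>. Starting from translates along - m \<nu>, infinitely many translates
   contain B \<nu>', so two of them agree; hence the stabilizer has corank 1. An element of I that is
   invariant under the stabilizer is a polynomial in one integral functional \<alpha>, so I contains some
   \<alpha> + k, which then divides every element of I. *)
theory Submission
  imports
    Defs
    "HOL-Computational_Algebra.Polynomial_Factorial"
    "HOL-Computational_Algebra.Fundamental_Theorem_Algebra"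
begin

interpretation complex: vector_space "scaleC :: complex \<Rightarrow> 'a \<Rightarrow> 'a::complex_space"
  by (rule vector_space_scaleC)

section \<open>Polynomials on a complex vector space\<close>

lemmas eval_simps [simp] =
  zero_polynomial.rep_eq one_polynomial.rep_eq plus_polynomial.rep_eq times_polynomial.rep_eq
  uminus_polynomial.rep_eq minus_polynomial.rep_eq shift_polynomial.rep_eq

lemma polynomial_eqI: "(\<And>x. eval p x = eval q x) \<Longrightarrow> p = q"
  by (simp add: eval_inject[symmetric] fun_eq_iff)

lift_definition const_polynomial :: "complex \<Rightarrow> 'a::complex_space polynomial" is "\<lambda>c x. c"
  by (rule polynomial_fun.const)

declare const_polynomial.rep_eq [simp]

lemma eval_Polynomial_linear [simp]: "linear_functional f \<Longrightarrow> eval (Polynomial f) = f"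
  by (simp add: Polynomial_inverse polynomial_fun.linear)

lemma polynomial_induct [case_names const linear add mult]:
  assumes "\<And>c. Q (const_polynomial c)" "\<And>f. linear_functional f \<Longrightarrow> Q (Polynomial f)"
    and "\<And>p q. Q p \<Longrightarrow> Q q \<Longrightarrow> Q (p + q)" "\<And>p q. Q p \<Longrightarrow> Q q \<Longrightarrow> Q (p * q)"
  shows "Q p"
proof -
  have "polynomial_fun (eval p)"
    using eval by auto
  then have "\<exists>q. Q q \<and> eval q = eval p"
  proof induction
    case (const c)
    show ?case by (rule exI[of _ "const_polynomial c"]) (simp add: assms fun_eq_iff)
  next
    case (linear f)
    then show ?case using assms(2) by (intro exI[of _ "Polynomial f"]) simp
  next
    case (add f g)
    then obtain p q where "Q p" "eval p = f" "Q q" "eval q = g" by blast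
    then show ?case using assms(3) by (intro exI[of _ "p + q"]) (auto simp: fun_eq_iff)
  next
    case (mult f g)
    then obtain p q where "Q p" "eval p = f" "Q q" "eval q = g" by blast
    then show ?case using assms(4) by (intro exI[of _ "p * q"]) (auto simp: fun_eq_iff)
  qed
  then show ?thesis by (auto simp: eval_inject)
qed

lemma shift_polynomial_add:
  "shift_polynomial m (p + q) = shift_polynomial m p + shift_polynomial m q"
  and shift_shift_polynomial:
  "shift_polynomial m (shift_polynomial n p) = shift_polynomial (m + n) p"
  and shift_polynomial_zero_vector [simp]: "shift_polynomial 0 p = p"
  by (auto intro!: polynomial_eqI simp: add.assoc)

lemma polynomial_in_functional:
  assumes "linear_functional f"
  shows "\<exists>r. \<forall>x. eval r x = poly p (f x)"
proof (induction p)
  case 0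
  show ?case by (rule exI[of _ 0]) simp
next
  case (pCons a p)
  then obtain r where "\<forall>x. eval r x = poly p (f x)" by blast
  then show ?case
    using assms by (intro exI[of _ "const_polynomial a + Polynomial f * r"]) simp
qed

section \<open>Expansion along a direction\<close>

text \<open>Covers both coefficient maps in use: evaluation at a point and the shift by a
  vector.\<close>

lemma map_poly_mult_hom:
  fixes h :: "'a::comm_semiring_0 \<Rightarrow> 'b::comm_semiring_0"
  assumes "h 0 = 0" "\<And>x y. h (x + y) = h x + h y" "\<And>x y. h (x * y) = h x * h y"
  shows "map_poly h (p * q) = map_poly h p * map_poly h q"
proof -
  have "h (sum g A) = (\<Sum>x\<in>A. h (g x))" for g :: "nat \<Rightarrow> 'a" and A
    by (induction A rule: infinite_finite_induct) (simp_all add: assms)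
  then show ?thesis
    by (intro poly_eqI) (simp add: coeff_map_poly coeff_mult assms)
qed

lemma map_poly_add_hom:
  assumes "h 0 = 0" "\<And>x y. h (x + y) = h x + h y"
  shows "map_poly h (p + q) = map_poly h p + map_poly h q"
  by (intro poly_eqI) (simp add: coeff_map_poly assms)

abbreviation eval_coeffs :: "'a::complex_space polynomial poly \<Rightarrow> 'a \<Rightarrow> complex poly" where
  "eval_coeffs F x \<equiv> map_poly (\<lambda>c. eval c x) F"

lemma eval_coeffs_add: "eval_coeffs (F + G) x = eval_coeffs F x + eval_coeffs G x"
  and eval_coeffs_mult: "eval_coeffs (F * G) x = eval_coeffs F x * eval_coeffs G x"
  by (simp_all add: map_poly_add_hom map_poly_mult_hom)

lemma taylor_exists: "\<exists>F. \<forall>x t. poly (eval_coeffs F x) t = eval f (x + t *\<^sub>C y)"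
proof (induction f rule: polynomial_induct)
  case (const c)
  show ?case by (rule exI[of _ "[:const_polynomial c:]"]) (simp add: map_poly_pCons)
next
  case (linear f)
  show ?case
    by (rule exI[of _ "[:Polynomial f, const_polynomial (f y):]"])
      (simp add: linear map_poly_pCons linear_functional_add[OF linear]
        linear_functional_scale[OF linear])
next
  case (add p q)
  then obtain F G where "\<forall>x t. poly (eval_coeffs F x) t = eval p (x + t *\<^sub>C y)"
    "\<forall>x t. poly (eval_coeffs G x) t = eval q (x + t *\<^sub>C y)" by blast
  then show ?case by (intro exI[of _ "F + G"]) (simp add: eval_coeffs_add)
next
  case (mult p q)
  then obtain F G where "\<forall>x t. poly (eval_coeffs F x) t = eval p (x + t *\<^sub>C y)"
    "\<forall>x t. poly (eval_coeffs G x) t = eval q (x + t *\<^sub>C y)" by blast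
  then show ?case by (intro exI[of _ "F * G"]) (simp add: eval_coeffs_mult)
qed

text \<open>The base point x ranges over the whole space, not over a complement of the line through
  \<open>y\<close>; hence a shift by any vector acts on the coefficients alone. The choice is
  harmless since \<open>F\<close> is unique, by \<open>taylor_eqI\<close>.\<close>

definition taylor :: "'a::complex_space \<Rightarrow> 'a polynomial \<Rightarrow> 'a polynomial poly" where
  "taylor y f = (SOME F. \<forall>x t. poly (eval_coeffs F x) t = eval f (x + t *\<^sub>C y))"

lemma poly_taylor: "poly (eval_coeffs (taylor y f) x) t = eval f (x + t *\<^sub>C y)"
  using someI_ex[OF taylor_exists[of f y]] unfolding taylor_def by blast

text \<open>A complex polynomial in t is determined by its values, and so is each coefficient as a
  polynomial in x.\<close>

lemma taylor_eqI:
  assumes "\<And>x t. poly (eval_coeffs F x) t = eval f (x + t *\<^sub>C y)"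
  shows "taylor y f = F"
proof -
  have "eval_coeffs (taylor y f) x = eval_coeffs F x" for x
    by (simp add: poly_eq_poly_eq_iff[symmetric] fun_eq_iff assms poly_taylor)
  then have "eval (coeff (taylor y f) n) x = eval (coeff F n) x" for n x
    by (metis (no_types, lifting) coeff_map_poly eval_simps(1))
  then show ?thesis
    by (intro poly_eqI polynomial_eqI)
qed

lemma taylor_add: "taylor y (f + g) = taylor y f + taylor y g"
  and taylor_mult: "taylor y (f * g) = taylor y f * taylor y g"
  and taylor_const [simp]: "taylor y (const_polynomial c) = [:const_polynomial c:]"
  and taylor_1 [simp]: "taylor y 1 = 1"
  and taylor_0 [simp]: "taylor y 0 = 0"
  by (rule taylor_eqI; simp add: eval_coeffs_add eval_coeffs_mult poly_taylor map_poly_pCons)+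

lemma taylor_diff: "taylor y (f - g) = taylor y f - taylor y g"
  using taylor_add[of y "f - g" g] by simp

lemma taylor_affine:
  assumes "linear_functional f"
  shows "taylor y (Polynomial f + const_polynomial k) =
    [:Polynomial f + const_polynomial k, const_polynomial (f y):]"
  using assms
  by (intro taylor_eqI) (simp add: map_poly_pCons linear_functional_add linear_functional_scale)

lemma taylor_shift: "taylor y (shift_polynomial m f) = map_poly (shift_polynomial m) (taylor y f)"
proof (rule taylor_eqI)
  fix x t
  have "eval_coeffs (map_poly (shift_polynomial m) (taylor y f)) x = eval_coeffs (taylor y f) (x + m)"
    by (intro poly_eqI) (simp add: coeff_map_poly shift_polynomial_0)
  then show "poly (eval_coeffs (map_poly (shift_polynomial m) (taylor y f)) x) t =
      eval (shift_polynomial m f) (x + t *\<^sub>C y)"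
    by (simp add: poly_taylor algebra_simps)
qed

text \<open>Set t = 0. This makes the expansion injective and later isolates \<open>g\<close> in
  \<open>affine_dvd\<close>.\<close>

lemma coeff_0_taylor: "coeff (taylor y f) 0 = f"
proof (rule polynomial_eqI)
  fix x
  have "eval (coeff (taylor y f) 0) x = poly (eval_coeffs (taylor y f) x) 0"
    by (simp add: poly_0_coeff_0 coeff_map_poly)
  then show "eval (coeff (taylor y f) 0) x = eval f x"
    by (simp add: poly_taylor)
qed

lemma taylor_eq_0_iff: "taylor y f = 0 \<longleftrightarrow> f = 0"
  by (metis coeff_0_taylor coeff_0 taylor_0)

lemma taylor_degree_0:
  assumes "degree (taylor y f) = 0"
  shows "eval f (x + t *\<^sub>C y) = eval f x"
proof -
  obtain c where c: "taylor y f = [:c:]"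
    using degree_eq_zeroE[OF assms] .
  have "eval f (x + t *\<^sub>C y) = eval c x" for t
    using poly_taylor[of x y f t] by (simp add: c map_poly_pCons)
  from this[of t] this[of 0] show ?thesis by simp
qed

lemma degree_taylor_mult:
  "f \<noteq> 0 \<Longrightarrow> g \<noteq> 0 \<Longrightarrow> degree (taylor y (f * g)) = degree (taylor y f) + degree (taylor y g)"
  by (simp add: taylor_mult degree_mult_eq taylor_eq_0_iff)

section \<open>Shifts of rational functions\<close>

lemma rational_of_polynomial_eq_to_fract: "rational_of_polynomial = to_fract"
  by (simp add: fun_eq_iff rational_of_polynomial_def to_fract_def)

lemma shift_to_fract: "shift m (to_fract p) = to_fract (shift_polynomial m p)"
  by (simp add: to_fract_def shift_Fract shift_polynomial_1)

lemma shift_rational_0: "shift m 0 = 0"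
  using shift_to_fract[of m 0] by (simp add: shift_polynomial_0)

lemma shift_rational_add: "shift m (f + g) = shift m f + shift m g"
  and shift_rational_mult: "shift m (f * g) = shift m f * shift m g"
  by (cases f; cases g; simp add: shift_Fract shift_polynomial_add shift_polynomial_mult
      shift_polynomial_eq_0_iff)+

lemma shift_shift_rational: "shift m (shift n f) = shift (m + n) f"
  and shift_rational_zero_vector: "shift 0 f = f"
  by (cases f; simp add: shift_Fract shift_shift_polynomial)+

abbreviation shift_coeffs ::
  "'a::complex_space \<Rightarrow> 'a rational_function poly \<Rightarrow> 'a rational_function poly" where
  "shift_coeffs m \<equiv> map_poly (shift m)"

lemma shift_coeffs_mult: "shift_coeffs m (p * q) = shift_coeffs m p * shift_coeffs m q"
  by (simp add: map_poly_mult_hom shift_rational_0 shift_rational_add shift_rational_mult)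

lemma shift_shift_coeffs: "shift_coeffs m (shift_coeffs n p) = shift_coeffs (m + n) p"
  by (simp add: map_poly_map_poly shift_rational_0 shift_shift_rational o_def)

lemma shift_coeffs_zero_vector [simp]: "shift_coeffs 0 p = p"
  by (rule map_poly_idI) (simp add: shift_rational_zero_vector)

lemma shift_coeffs_1: "shift_coeffs m 1 = 1"
  by (rule map_poly_1') (metis shift_to_fract shift_polynomial_1 to_fract_1)

text \<open>Shifting the coefficients is a ring automorphism whose inverse is the shift by
  \<open>- m\<close>.\<close>

lemma shift_coeffs_dvd_iff: "shift_coeffs m p dvd shift_coeffs m q \<longleftrightarrow> p dvd q"
proof
  have mono: "shift_coeffs n p dvd shift_coeffs n q" if "p dvd q"
    for n :: 'a and p q :: "'a rational_function poly"
    using that by (auto simp: shift_coeffs_mult)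
  show "p dvd q \<Longrightarrow> shift_coeffs m p dvd shift_coeffs m q" by (rule mono)
  show "p dvd q" if "shift_coeffs m p dvd shift_coeffs m q"
    using mono[OF that, of "- m"] by (simp add: shift_shift_coeffs)
qed

lemma irreducible_shift_coeffs:
  assumes "irreducible p"
  shows "irreducible (shift_coeffs m p)"
proof (rule irreducibleI)
  show "shift_coeffs m p \<noteq> 0"
    using assms shift_coeffs_dvd_iff[of m 0 p] by auto
  show "\<not> shift_coeffs m p dvd 1"
    using assms shift_coeffs_dvd_iff[of m p 1] by (auto simp: shift_coeffs_1 irreducible_def)
  fix a b assume "shift_coeffs m p = a * b"
  then have "p = shift_coeffs (- m) a * shift_coeffs (- m) b"
    by (metis shift_coeffs_mult shift_shift_coeffs shift_coeffs_zero_vector left_minus)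
  then have "shift_coeffs (- m) a dvd 1 \<or> shift_coeffs (- m) b dvd 1"
    using assms irreducibleD by blast
  then show "a dvd 1 \<or> b dvd 1"
    by (metis shift_coeffs_1 shift_coeffs_dvd_iff)
qed

lemma fract_poly_taylor_shift:
  "fract_poly (taylor y (shift_polynomial m f)) = shift_coeffs m (fract_poly (taylor y f))"
  by (intro poly_eqI)
    (simp add: taylor_shift coeff_map_poly shift_to_fract shift_rational_0 shift_polynomial_0)

section \<open>Prime ideals with finitely many shifts over each polynomial\<close>

definition stabilizer :: "'a::complex_space polynomial set \<Rightarrow> 'a set" where
  "stabilizer I = {s. \<forall>f. shift_polynomial s f \<in> I \<longleftrightarrow> f \<in> I}"

text \<open>\<open>pigeonhole\<close> is what remains of factoriality: up to the stabilizer, only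
  finitely many shifts bring a nonzero \<open>f\<close> into the prime ideal \<open>I\<close>. It is
  stated for sequences because the shifts will be produced one for each natural number.\<close>

locale shift_finite_prime =
  fixes I :: "'v::complex_space polynomial set"
  assumes diff_mem: "f \<in> I \<Longrightarrow> g \<in> I \<Longrightarrow> f - g \<in> I"
    and mult_mem: "f \<in> I \<Longrightarrow> f * g \<in> I"
    and one_not_mem: "1 \<notin> I"
    and prime: "f * g \<in> I \<Longrightarrow> f \<in> I \<or> g \<in> I"
    and pigeonhole: "f \<noteq> 0 \<Longrightarrow> (\<And>m. shift_polynomial (s m) f \<in> I) \<Longrightarrow>
      \<exists>(m::nat) n. m < n \<and> s n - s m \<in> stabilizer I"

section \<open>Irreducible divisors of a polynomial in one variable over a field\<close>

lemma irreducible_dvd_imp_dvd: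
  fixes p q :: "'a::idom"
  assumes "irreducible p" "irreducible q" "p dvd q"
  shows "q dvd p"
proof -
  obtain c where c: "q = p * c"
    using assms(3) ..
  then have "c dvd 1"
    using assms(1,2) irreducibleD irreducible_not_unit by blast
  then obtain d where "1 = c * d" ..
  then have "p = q * d"
    by (simp add: c mult.assoc)
  then show ?thesis ..
qed

lemma prime_elem_dvd_prod:
  assumes "prime_elem p" "finite A" "p dvd prod f A"
  shows "\<exists>i\<in>A. p dvd f i"
  using assms(2,3)
proof (induction A rule: finite_induct)
  case empty
  then show ?case using assms(1) by (auto simp: prime_elem_def)
qed (use assms(1) in \<open>auto simp: prime_elem_dvd_mult_iff\<close>)

text \<open>If no \<open>Q m\<close> divided a later one, they would be pairwise non-associated
  primes, so the product of any number of them would divide \<open>g\<close>. Each has positive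
  degree, so such products outgrow the degree of \<open>g\<close>.\<close>

lemma irreducible_divisors_pigeonhole:
  fixes g :: "'k::field poly"
  assumes "g \<noteq> 0" "\<And>m::nat. irreducible (Q m)" "\<And>m. Q m dvd g"
  shows "\<exists>m n. m < n \<and> Q m dvd Q n"
proof (rule ccontr)
  assume contra: "\<not> ?thesis"
  have deg: "degree (Q m) > 0" for m
    using assms(2)[of m] by (auto simp: irreducible_def is_unit_iff_degree)
  have "(\<Prod>i<n. Q i) dvd g \<and> n \<le> degree (\<Prod>i<n. Q i)" for n
  proof (induction n)
    case (Suc n)
    then obtain h where h: "g = (\<Prod>i<n. Q i) * h" by blast
    have pr: "prime_elem (Q n)"
      using assms(2) field_poly_irreducible_imp_prime by blast
    have "\<not> Q n dvd (\<Prod>i<n. Q i)"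
    proof
      assume "Q n dvd (\<Prod>i<n. Q i)"
      then obtain i where "i < n" "Q n dvd Q i"
        using prime_elem_dvd_prod[OF pr, of "{..<n}" Q] by auto
      then show False
        using contra irreducible_dvd_imp_dvd assms(2) by blast
    qed
    then have "Q n dvd h"
      using assms(3)[of n] pr prime_elem_dvd_mult_iff h by metis
    then have "(\<Prod>i<Suc n. Q i) dvd g"
      using h by (simp add: mult_dvd_mono)
    moreover have "(\<Prod>i<n. Q i) \<noteq> 0" "Q n \<noteq> 0"
      using assms(1) h pr by (auto simp del: prod_zero_iff)
    then have "Suc n \<le> degree (\<Prod>i<Suc n. Q i)"
      using Suc deg[of n] by (simp add: degree_mult_eq)
    ultimately show ?case by blast
  qed simp
  then have "Suc (degree g) \<le> degree (\<Prod>i<Suc (degree g). Q i)" "(\<Prod>i<Suc (degree g). Q i) dvd g"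
    by blast+
  then show False
    using dvd_imp_degree_le[OF _ assms(1)] by (meson not_less_eq_eq le_trans)
qed

text \<open>A shift brings \<open>f\<close> into the ideal exactly if \<open>P\<close>, shifted
  backwards, divides the expansion of \<open>f\<close>. Among infinitely many such irreducible
  divisors two are associated, and the difference of their shifts preserves divisibility by
  \<open>P\<close>.\<close>

lemma shift_finite_prime_irreducible:
  assumes P: "irreducible P"
  shows "shift_finite_prime {f. P dvd fract_poly (taylor e f)}" (is "shift_finite_prime ?I")
proof
  have pr: "prime_elem P"
    using P by (rule field_poly_irreducible_imp_prime)
  show "f - g \<in> ?I" if "f \<in> ?I" "g \<in> ?I" for f g
    using that by (simp add: taylor_diff)
  show "f * g \<in> ?I" if "f \<in> ?I" for f g
    using that by (simp add: taylor_mult)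
  show "1 \<notin> ?I"
    using P by (simp add: irreducible_def)
  show "f \<in> ?I \<or> g \<in> ?I" if "f * g \<in> ?I" for f g
    using that pr by (simp add: taylor_mult prime_elem_dvd_mult_iff)
  fix f :: "'a polynomial" and s :: "nat \<Rightarrow> 'a"
  assume "f \<noteq> 0" and mem: "\<And>m. shift_polynomial (s m) f \<in> ?I"
  let ?Q = "\<lambda>m. shift_coeffs (- s m) P"
  have "?Q m dvd fract_poly (taylor e f)" for m
    using mem[of m] shift_coeffs_dvd_iff[of "s m" "?Q m"]
    by (simp add: fract_poly_taylor_shift shift_shift_coeffs)
  moreover have irr: "irreducible (?Q m)" for m
    using P by (rule irreducible_shift_coeffs)
  ultimately obtain m n where mn: "m < n" "?Q m dvd ?Q n"
    using irreducible_divisors_pigeonhole[of "fract_poly (taylor e f)" ?Q] \<open>f \<noteq> 0\<close>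
    by (auto simp: taylor_eq_0_iff)
  define d where "d = s n - s m"
  from mn have "shift_coeffs d P dvd P"
    using shift_coeffs_dvd_iff[of "s n" "?Q m" "?Q n"] by (simp add: shift_shift_coeffs d_def)
  moreover have "P dvd shift_coeffs d P"
    using irreducible_dvd_imp_dvd[OF irr irr mn(2)] shift_coeffs_dvd_iff[of "s n" "?Q n" "?Q m"]
    by (simp add: shift_shift_coeffs d_def)
  ultimately have "P dvd shift_coeffs d F \<longleftrightarrow> P dvd F" for F
    using shift_coeffs_dvd_iff[of d P F] dvd_trans by blast
  then have "d \<in> stabilizer ?I"
    by (simp add: stabilizer_def fract_poly_taylor_shift)
  then show "\<exists>m n. m < n \<and> s n - s m \<in> stabilizer ?I"
    using mn d_def by blast
qed


section \<open>Primes over a polynomial cocycle\<close>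

text \<open>Keeps only the part of the cocycle on \<Omega>, where all values are polynomials.
  Negatives of elements of \<Omega> will occur as shifts, but not as indices of
  \<open>B\<close>.\<close>

locale polynomial_cocycle =
  fixes \<Omega> :: "'v::complex_space set" and B :: "'v \<Rightarrow> 'v polynomial"
  assumes zero_mem: "0 \<in> \<Omega>"
    and add_mem: "\<mu> \<in> \<Omega> \<Longrightarrow> \<nu> \<in> \<Omega> \<Longrightarrow> \<mu> + \<nu> \<in> \<Omega>"
    and nonzero: "\<mu> \<in> \<Omega> \<Longrightarrow> B \<mu> \<noteq> 0"
    and cocycle: "\<mu> \<in> \<Omega> \<Longrightarrow> \<nu> \<in> \<Omega> \<Longrightarrow> B \<mu> * shift_polynomial \<mu> (B \<nu>) = B (\<mu> + \<nu>)"
begin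

lemma nat_scale_mem: "\<nu> \<in> \<Omega> \<Longrightarrow> of_nat n *\<^sub>C \<nu> \<in> \<Omega>"
  by (induction n) (simp_all add: zero_mem add_mem complex.scale_left_distrib)

end

locale cocycle_prime = polynomial_cocycle \<Omega> B + shift_finite_prime I
  for \<Omega> :: "'v::complex_space set" and B and I :: "'v polynomial set"
begin

text \<open>Torsion of the class of \<nu> in the additive group of the space modulo the
  stabilizer.\<close>

definition torsion :: "'v \<Rightarrow> bool" where
  "torsion \<nu> \<longleftrightarrow> (\<exists>n::int. n \<noteq> 0 \<and> of_int n *\<^sub>C \<nu> \<in> stabilizer I)"

text \<open>As long as the translates of \<open>B \<nu>\<close> along \<nu> stay outside
  \<open>I\<close>, primality and the cocycle identity carry membership of \<open>B \<kappa>\<close>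
  one step further along \<nu>. If this never stopped, \<open>pigeonhole\<close> would make \<nu>
  torsion.\<close>

lemma torsion_or_escape:
  assumes "\<kappa> \<in> \<Omega>" "\<nu> \<in> \<Omega>" "shift_polynomial c (B \<kappa>) \<in> I" "\<not> torsion \<nu>"
  shows "\<exists>i::nat. shift_polynomial (c + of_nat i *\<^sub>C \<nu>) (B \<nu>) \<in> I"
proof (rule ccontr)
  assume contra: "\<not> ?thesis"
  let ?s = "\<lambda>n. c + of_nat n *\<^sub>C \<nu>"
  have mem: "shift_polynomial (?s n) (B \<kappa>) \<in> I" for n
  proof (induction n)
    case 0
    show ?case using assms(3) by simp
  next
    case (Suc n)
    \<comment> \<open>Both products equal \<open>B (\<kappa> + \<nu>)\<close>.\<close>
    have "B \<kappa> * shift_polynomial \<kappa> (B \<nu>) = B \<nu> * shift_polynomial \<nu> (B \<kappa>)"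
      using assms(1,2) by (simp add: cocycle add.commute)
    then have "shift_polynomial (?s n) (B \<kappa>) * shift_polynomial (?s n) (shift_polynomial \<kappa> (B \<nu>)) =
        shift_polynomial (?s n) (B \<nu>) * shift_polynomial (?s n) (shift_polynomial \<nu> (B \<kappa>))"
      by (metis shift_polynomial_mult)
    then have "shift_polynomial (?s n) (B \<nu>) * shift_polynomial (?s (Suc n)) (B \<kappa>) \<in> I"
      using mult_mem[OF Suc, of "shift_polynomial (?s n) (shift_polynomial \<kappa> (B \<nu>))"]
      by (simp add: shift_shift_polynomial complex.scale_left_distrib algebra_simps)
    then show ?case
      using prime[of "shift_polynomial (?s n) (B \<nu>)" "shift_polynomial (?s (Suc n)) (B \<kappa>)"] contra
      by blast
  qed
  obtain m n where "m < n" "?s n - ?s m \<in> stabilizer I"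
    using pigeonhole[OF nonzero[OF assms(1)], of ?s] mem by blast
  then have "of_int (int n - int m) *\<^sub>C \<nu> \<in> stabilizer I" "int n - int m \<noteq> 0"
    by (simp_all add: complex.scale_left_diff_distrib)
  then show False
    using assms(4) unfolding torsion_def by blast
qed

text \<open>Escaping along \<nu>' from each of the positions c - m \<nu> yields infinitely many
  shifts of \<open>B \<nu>'\<close> in \<open>I\<close>; two of them agree modulo the stabilizer,
  and their difference is the relation.\<close>

lemma stabilizer_relation:
  assumes "\<nu> \<in> \<Omega>" "\<not> torsion \<nu>" "shift_polynomial c (B \<nu>) \<in> I" "\<nu>' \<in> \<Omega>"
  shows "\<exists>j k :: int. k \<noteq> 0 \<and> of_int j *\<^sub>C \<nu> + of_int k *\<^sub>C \<nu>' \<in> stabilizer I"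
proof (cases "torsion \<nu>'")
  case True
  then show ?thesis
    unfolding torsion_def by (metis add_0 complex.scale_zero_left of_int_0)
next
  case False
  have "\<exists>i::nat. shift_polynomial (c - of_nat m *\<^sub>C \<nu> + of_nat i *\<^sub>C \<nu>') (B \<nu>') \<in> I" for m
  proof -
    \<comment> \<open>The last factor of B((m+1) \<nu>) is \<open>B \<nu>\<close> shifted by m
      \<nu>; shifting back by m \<nu> puts it at position \<open>c\<close>, where it lies in
      \<open>I\<close>.\<close>
    have "B (of_nat m *\<^sub>C \<nu> + \<nu>) = B (of_nat m *\<^sub>C \<nu>) * shift_polynomial (of_nat m *\<^sub>C \<nu>) (B \<nu>)"
      using cocycle nat_scale_mem assms(1) by metis
    then have "shift_polynomial (c - of_nat m *\<^sub>C \<nu>) (B (of_nat m *\<^sub>C \<nu> + \<nu>)) =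
        shift_polynomial c (B \<nu>) * shift_polynomial (c - of_nat m *\<^sub>C \<nu>) (B (of_nat m *\<^sub>C \<nu>))"
      by (simp add: shift_polynomial_mult shift_shift_polynomial mult.commute)
    then have "shift_polynomial (c - of_nat m *\<^sub>C \<nu>) (B (of_nat m *\<^sub>C \<nu> + \<nu>)) \<in> I"
      using mult_mem[OF assms(3)] by simp
    then show ?thesis
      using torsion_or_escape[OF _ assms(4) _ False] add_mem nat_scale_mem assms(1) by blast
  qed
  then obtain i where i:
    "\<And>m. shift_polynomial (c - of_nat m *\<^sub>C \<nu> + of_nat (i m) *\<^sub>C \<nu>') (B \<nu>') \<in> I"
    by metis
  obtain m n where mn: "m < n"
    "(c - of_nat n *\<^sub>C \<nu> + of_nat (i n) *\<^sub>C \<nu>') - (c - of_nat m *\<^sub>C \<nu> + of_nat (i m) *\<^sub>C \<nu>')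
      \<in> stabilizer I"
    using pigeonhole[OF nonzero[OF assms(4)], of "\<lambda>m. c - of_nat m *\<^sub>C \<nu> + of_nat (i m) *\<^sub>C \<nu>'"] i
    by blast
  define j where "j = int m - int n"
  define k where "k = int (i n) - int (i m)"
  have rel: "of_int j *\<^sub>C \<nu> + of_int k *\<^sub>C \<nu>' \<in> stabilizer I"
    using mn(2) by (simp add: j_def k_def complex.scale_left_diff_distrib algebra_simps)
  \<comment> \<open>Otherwise j \<nu> alone would lie in the stabilizer with j = m - n nonzero,
    making \<nu> torsion.\<close>
  have "k \<noteq> 0"
  proof
    assume "k = 0"
    then show False
      using rel assms(2) mn(1) unfolding torsion_def
      by (metis add_0_right complex.scale_zero_left diff_eq_eq j_def less_irrefl of_int_0 of_nat_eq_iff add_0)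
  qed
  then show ?thesis
    using rel by blast
qed

end

section \<open>Finite differences and elements invariant under the stabilizer\<close>

text \<open>The condition of total degree less than n, expressed by finite differences, which stay
  in \<open>I\<close> when the step lies in the stabilizer.\<close>

primrec diff_nilpotent :: "nat \<Rightarrow> 'a::complex_space polynomial \<Rightarrow> bool" where
  "diff_nilpotent 0 f \<longleftrightarrow> f = 0"
| "diff_nilpotent (Suc n) f \<longleftrightarrow> (\<forall>s. diff_nilpotent n (shift_polynomial s f - f))"

lemma diff_nilpotent_0: "diff_nilpotent n 0"
  by (induction n) (simp_all add: shift_polynomial_0)

lemma diff_nilpotent_mono: "diff_nilpotent n f \<Longrightarrow> n \<le> m \<Longrightarrow> diff_nilpotent m f"
proof (induction n arbitrary: f m)
  case 0
  then show ?case by (simp add: diff_nilpotent_0)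
next
  case (Suc n)
  then show ?case by (cases m) auto
qed

lemma diff_nilpotent_add: "diff_nilpotent n f \<Longrightarrow> diff_nilpotent n g \<Longrightarrow> diff_nilpotent n (f + g)"
proof (induction n arbitrary: f g)
  case (Suc n)
  have "diff_nilpotent n ((shift_polynomial s f - f) + (shift_polynomial s g - g))" for s
    using Suc by simp
  then show ?case
    by (simp add: shift_polynomial_add algebra_simps)
qed simp

text \<open>Discrete Leibniz rule: the difference of f g is df g + f dg + df dg, and each term has a
  smaller sum of orders.\<close>

lemma diff_nilpotent_mult:
  "diff_nilpotent n f \<Longrightarrow> diff_nilpotent m g \<Longrightarrow> diff_nilpotent (n + m) (f * g)"
proof (induction "n + m" arbitrary: n m f g rule: less_induct)
  case less
  show ?case
  proof (cases "n = 0 \<or> m = 0")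
    case True
    with less.prems have "f = 0 \<or> g = 0"
      by auto
    then show ?thesis
      by (auto simp: diff_nilpotent_0)
  next
    case False
    then obtain n' m' where n': "n = Suc n'" and m': "m = Suc m'"
      by (meson not0_implies_Suc)
    have "diff_nilpotent (n' + m) (shift_polynomial s (f * g) - f * g)" for s
    proof -
      define df where "df = shift_polynomial s f - f"
      define dg where "dg = shift_polynomial s g - g"
      have df: "diff_nilpotent n' df" and dg: "diff_nilpotent m' dg"
        using less.prems by (simp_all add: n' m' df_def dg_def)
      have "diff_nilpotent (n' + m) (df * g)"
        using less.hyps[of n' m] df less.prems(2) by (simp add: n')
      moreover have "diff_nilpotent (n' + m) (f * dg)"
        using less.hyps[of n m'] dg less.prems(1) by (simp add: n' m')
      moreover have "diff_nilpotent (n' + m) (df * dg)"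
        using less.hyps[of n' m'] df dg diff_nilpotent_mono[of "n' + m'" "df * dg" "n' + m"] n' m'
        by (simp del: diff_nilpotent.simps)
      ultimately have "diff_nilpotent (n' + m) (df * g + f * dg + df * dg)"
        by (intro diff_nilpotent_add)
      moreover have "df * g + f * dg + df * dg = shift_polynomial s (f * g) - f * g"
        by (simp add: df_def dg_def shift_polynomial_mult algebra_simps)
      ultimately show ?thesis
        by simp
    qed
    then show ?thesis
      by (simp add: n')
  qed
qed

lemma diff_nilpotent_exists: "\<exists>n. diff_nilpotent n f"
proof (induction f rule: polynomial_induct)
  case (const c)
  have "shift_polynomial s (const_polynomial c) - const_polynomial c = 0" for s :: 'a
    by (rule polynomial_eqI) simp
  then show ?case
    by (intro exI[of _ 1]) simp
next
  case (linear f)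
  have "shift_polynomial s (Polynomial f) - Polynomial f = const_polynomial (f s)" for s
    using linear by (intro polynomial_eqI) (simp add: linear_functional_add)
  moreover have "shift_polynomial s (const_polynomial c) - const_polynomial c = 0" for s :: 'a and c
    by (rule polynomial_eqI) simp
  ultimately show ?case
    by (intro exI[of _ "Suc (Suc 0)"]) simp
next
  case (add p q)
  then show ?case
    using diff_nilpotent_add diff_nilpotent_mono by (metis nat_le_linear)
next
  case (mult p q)
  then show ?case
    using diff_nilpotent_mult by blast
qed

text \<open>If some \<open>s\<close> in the stabilizer moves \<open>f\<close>, the difference of
  \<open>f\<close> along \<open>s\<close> is again a nonzero element of \<open>I\<close>, of lower
  order. This descent ends at an invariant element.\<close>

lemma (in shift_finite_prime) invariant_element:
  assumes "f \<in> I" "f \<noteq> 0"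
  shows "\<exists>g\<in>I. g \<noteq> 0 \<and> (\<forall>s\<in>stabilizer I. shift_polynomial s g = g)"
proof -
  obtain n where "diff_nilpotent n f"
    using diff_nilpotent_exists by blast
  then show ?thesis
    using assms
  proof (induction n arbitrary: f)
    case (Suc n)
    show ?case
    proof (cases "\<forall>s\<in>stabilizer I. shift_polynomial s f = f")
      case False
      then obtain s where "s \<in> stabilizer I" "shift_polynomial s f - f \<noteq> 0"
        by auto
      moreover from this have "shift_polynomial s f - f \<in> I"
        using Suc.prems diff_mem by (simp add: stabilizer_def)
      ultimately show ?thesis
        using Suc.IH[of "shift_polynomial s f - f"] Suc.prems(1) by simp
    qed (use Suc.prems in blast)
  qed simp
qed

section \<open>Linear elements of the primes\<close>

text \<open>All complex multiples of the vector are required, so that the periods form a complex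
  subspace and not just a subgroup.\<close>

definition periods :: "'a::complex_space polynomial \<Rightarrow> 'a set" where
  "periods f = {v. \<forall>x t. eval f (x + t *\<^sub>C v) = eval f x}"

lemma subspace_periods: "complex.subspace (periods f)"
proof (rule complex.subspaceI)
  show "0 \<in> periods f"
    by (simp add: periods_def)
  show "v + w \<in> periods f" if "v \<in> periods f" "w \<in> periods f" for v w
    using that by (simp add: periods_def complex.scale_right_distrib flip: add.assoc)
  show "c *\<^sub>C v \<in> periods f" if "v \<in> periods f" for c v
    using that by (simp add: periods_def)
qed

text \<open>Along the line through x in direction \<open>s\<close>, \<open>f\<close> is a polynomial
  in t that takes the value f(x) at every natural number, hence is constant.\<close>

lemma shift_invariant_imp_period:
  assumes "shift_polynomial s f = f"
  shows "s \<in> periods f"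
proof -
  have nat: "eval f (x + of_nat n *\<^sub>C s) = eval f x" for x n
  proof (induction n)
    case (Suc n)
    have "eval f (x + of_nat (Suc n) *\<^sub>C s) = eval (shift_polynomial s f) (x + of_nat n *\<^sub>C s)"
      by (simp add: complex.scale_left_distrib algebra_simps)
    then show ?case
      using assms Suc by simp
  qed simp
  have "eval f (x + t *\<^sub>C s) = eval f x" for x t
  proof -
    let ?p = "eval_coeffs (taylor s f) x - [:eval f x:]"
    have "range of_nat \<subseteq> {z. poly ?p z = 0}"
      by (auto simp: poly_taylor nat)
    moreover have "infinite (range (of_nat :: nat \<Rightarrow> complex))"
      by (simp add: finite_image_iff inj_of_nat)
    ultimately have "?p = 0"
      using poly_roots_finite finite_subset by blast
    then have "poly ?p t = 0"
      by (simp only: poly_0)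
    then show ?thesis
      by (simp add: poly_taylor)
  qed
  then show ?thesis
    by (simp add: periods_def)
qed

text \<open>\<open>D\<close> is a complement of the line through \<nu>, and \<alpha> is the
  coordinate along that line; linearity follows from uniqueness of the coordinate.\<close>

lemma complementary_functional:
  fixes D :: "'a::complex_space set"
  assumes D: "complex.subspace D" and \<nu>: "\<nu> \<notin> D" and total: "\<And>x. \<exists>z. x - z *\<^sub>C \<nu> \<in> D"
  obtains \<alpha> where "linear_functional \<alpha>" "\<And>x z. x - z *\<^sub>C \<nu> \<in> D \<longleftrightarrow> z = \<alpha> x"
proof -
  have uniq: "z = w" if "x - z *\<^sub>C \<nu> \<in> D" "x - w *\<^sub>C \<nu> \<in> D" for x z w
  proof (rule ccontr)
    assume "z \<noteq> w"
    have "(x - w *\<^sub>C \<nu>) - (x - z *\<^sub>C \<nu>) \<in> D"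
      by (rule complex.subspace_diff[OF D that(2,1)])
    then have "(z - w) *\<^sub>C \<nu> \<in> D"
      by (simp add: complex.scale_left_diff_distrib)
    from complex.subspace_scale[OF D this, of "1 / (z - w)"] \<open>z \<noteq> w\<close> \<nu> show False
      by simp
  qed
  obtain \<alpha> where mem: "\<And>x. x - \<alpha> x *\<^sub>C \<nu> \<in> D"
    using total by metis
  have iff: "x - z *\<^sub>C \<nu> \<in> D \<longleftrightarrow> z = \<alpha> x" for x z
    using uniq mem by blast
  have "\<alpha> (x + y) = \<alpha> x + \<alpha> y" for x y
  proof -
    have "(x + y) - (\<alpha> x + \<alpha> y) *\<^sub>C \<nu> \<in> D"
      using complex.subspace_add[OF D mem[of x] mem[of y]]
      by (simp add: complex.scale_left_distrib algebra_simps)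
    then show ?thesis by (simp add: iff)
  qed
  moreover have "\<alpha> (c *\<^sub>C x) = c * \<alpha> x" for c x
  proof -
    have "c *\<^sub>C x - (c * \<alpha> x) *\<^sub>C \<nu> \<in> D"
      using complex.subspace_scale[OF D mem[of x], of c] by (simp add: complex.scale_right_diff_distrib)
    then show ?thesis by (simp add: iff)
  qed
  moreover have "vector_space ((*) :: complex \<Rightarrow> complex \<Rightarrow> complex)"
    by unfold_locales (simp_all add: algebra_simps)
  ultimately have "linear_functional \<alpha>"
    by (simp add: Vector_Spaces.linear_iff vector_space_scaleC)
  then show ?thesis
    using that iff by blast
qed

lemma linear_functional_diff: "linear_functional f \<Longrightarrow> f (x - y) = f x - f y"
  using linear_functional_add[of f "x - y" y] by simp

lemma linear_functional_zero: "linear_functional f \<Longrightarrow> f 0 = 0"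
  using linear_functional_diff[of f 0 0] by simp

lemma linear_functional_mult_left: "linear_functional f \<Longrightarrow> linear_functional (\<lambda>x. c * f x)"
  by (simp add: Vector_Spaces.linear_iff algebra_simps)

lemma integral_functionalI:
  assumes f: "linear_functional f" and int: "\<And>x. x \<in> L \<Longrightarrow> f x \<in> \<int>"
  shows "f \<in> integral_functionals L"
proof -
  \<comment> \<open>The witness must be integer-valued everywhere; only on \<open>L\<close> does it
    agree with \<open>f\<close>.\<close>
  let ?a = "\<lambda>x. \<lfloor>Re (f x)\<rfloor>"
  have fa: "f x = of_int (?a x)" if "x \<in> L" for x
    using int[OF that] by (auto elim!: Ints_cases)
  moreover have "?a (x + y) = ?a x + ?a y" if "x \<in> L" "y \<in> L" for x y
    using int[OF that(1)] int[OF that(2)] linear_functional_add[OF f, of x y]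
    by (auto elim!: Ints_cases)
  ultimately have "(\<forall>x\<in>L. \<forall>y\<in>L. ?a (x + y) = ?a x + ?a y) \<and> (\<forall>x\<in>L. f x = of_int (?a x))"
    by blast
  then show ?thesis
    using f unfolding integral_functionals_def by (intro CollectI conjI exI[of _ ?a]) auto
qed

lemma zero_integral_functional: "(\<lambda>x. 0) \<in> integral_functionals L"
proof (rule integral_functionalI)
  have "vector_space ((*) :: complex \<Rightarrow> complex \<Rightarrow> complex)"
    by unfold_locales (simp_all add: algebra_simps)
  then show "linear_functional (\<lambda>x. 0)"
    by (simp add: Vector_Spaces.linear_iff vector_space_scaleC)
qed simp

lemma Ints_on_group_closure:
  assumes "linear_functional f" "\<And>s. s \<in> S \<Longrightarrow> f s \<in> \<int>" "x \<in> group_closure (monoid_closure S)"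
  shows "f x \<in> \<int>"
proof -
  have "f y \<in> \<int>" if "y \<in> monoid_closure S" for y
    using that by induction (simp_all add: assms linear_functional_add linear_functional_zero)
  then show ?thesis
    by (rule group_closure.induct[OF assms(3)])
      (auto simp: assms(1) linear_functional_diff linear_functional_zero monoid_closure.zero)
qed

lemma common_denominator:
  fixes f :: "'a \<Rightarrow> complex"
  assumes "finite S" "\<And>s. s \<in> S \<Longrightarrow> \<exists>k::int. k \<noteq> 0 \<and> of_int k * f s \<in> \<int>"
  shows "\<exists>k::int. k \<noteq> 0 \<and> (\<forall>s\<in>S. of_int k * f s \<in> \<int>)"
  using assms
proof (induction S rule: finite_induct)
  case (insert s S)
  then obtain k :: int where "k \<noteq> 0" "\<forall>s\<in>S. of_int k * f s \<in> \<int>"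
    by auto
  moreover obtain l :: int where "l \<noteq> 0" "of_int l * f s \<in> \<int>"
    using insert.prems by blast
  ultimately have kl: "k \<noteq> 0" "\<forall>s\<in>S. of_int k * f s \<in> \<int>" "l \<noteq> 0" "of_int l * f s \<in> \<int>" .
  have "of_int (k * l) * f s' = of_int l * (of_int k * f s')"
    "of_int (k * l) * f s' = of_int k * (of_int l * f s')" for s'
    by simp_all
  then have "\<forall>s'\<in>insert s S. of_int (k * l) * f s' \<in> \<int>"
    using kl by (metis Ints_mult Ints_of_int insertE)
  then show ?case
    using kl(1,3) by (intro exI[of _ "k * l"]) simp
qed (auto intro: exI[of _ 1])

context shift_finite_prime
begin

lemma const_not_mem: "c \<noteq> 0 \<Longrightarrow> const_polynomial c \<notin> I"
proof
  assume "c \<noteq> 0" "const_polynomial c \<in> I"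
  then have "const_polynomial c * const_polynomial (1 / c) \<in> I"
    using mult_mem by blast
  moreover have "const_polynomial c * const_polynomial (1 / c) = (1 :: 'v polynomial)"
    using \<open>c \<noteq> 0\<close> by (intro polynomial_eqI) simp
  ultimately show False
    using one_not_mem by simp
qed

text \<open>Over the complex numbers \<open>p\<close> splits into linear factors, and primality puts
  one of the corresponding factors of \<open>f\<close> into \<open>I\<close>. Degree 0 cannot occur,
  since nonzero constants are units.\<close>

lemma linear_factor_mem:
  assumes \<alpha>: "linear_functional \<alpha>" and "f \<in> I" "p \<noteq> 0" "\<And>x. eval f x = poly p (\<alpha> x)"
  shows "\<exists>r. Polynomial \<alpha> - const_polynomial r \<in> I"
  using assms(2-4)
proof (induction "degree p" arbitrary: p f)
  case 0
  then obtain c where "p = [:c:]" "c \<noteq> 0"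
    by (metis degree_eq_zeroE pCons_0_0)
  then have "f = const_polynomial c"
    using 0 by (intro polynomial_eqI) simp
  then show ?case
    using const_not_mem[OF \<open>c \<noteq> 0\<close>] 0 by simp
next
  case (Suc n)
  have "\<not> constant (poly p)"
    using Suc.hyps(2) by (simp add: constant_degree)
  then obtain r where "poly p r = 0"
    using fundamental_theorem_of_algebra by blast
  then obtain q where q: "p = [:- r, 1:] * q"
    by (auto simp: poly_eq_0_iff_dvd)
  obtain g where g: "\<And>x. eval g x = poly q (\<alpha> x)"
    using polynomial_in_functional[OF \<alpha>] by blast
  have "q \<noteq> 0"
    using q Suc.prems(2) by auto
  then have deg: "degree p = Suc (degree q)"
    unfolding q by (subst degree_mult_eq) auto
  have "f = (Polynomial \<alpha> - const_polynomial r) * g"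
    using \<alpha> by (intro polynomial_eqI) (simp add: Suc.prems(3) q g left_diff_distrib)
  then have "Polynomial \<alpha> - const_polynomial r \<in> I \<or> g \<in> I"
    using Suc.prems(1) prime by blast
  then show ?case
    using Suc.hyps(1)[of q g] Suc.hyps(2) deg \<open>q \<noteq> 0\<close> g by auto
qed

end

text \<open>The relations in the stabilizer make the periods of an invariant \<open>f\<close> in
  \<open>I\<close> a hyperplane. So \<open>f\<close> is a polynomial in one coordinate, which is
  rational on \<Omega>, and \<open>linear_factor_mem\<close> applies.\<close>

lemma (in cocycle_prime) integral_affine_member:
  assumes gens: "finite S" "\<Omega> = monoid_closure S" and span: "complex.span \<Omega> = UNIV"
    and \<mu>: "\<mu> \<in> \<Omega>" "B \<mu> \<in> I"
  shows "\<exists>\<alpha>\<in>integral_functionals (group_closure \<Omega>). \<exists>k.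
    Polynomial \<alpha> + const_polynomial k \<in> I \<and> Polynomial \<alpha> + const_polynomial k \<noteq> 0"
proof -
  obtain f where f: "f \<in> I" "f \<noteq> 0" "\<And>s. s \<in> stabilizer I \<Longrightarrow> shift_polynomial s f = f"
    using invariant_element[OF \<mu>(2) nonzero[OF \<mu>(1)]] by blast
  let ?D = "periods f"
  note D = subspace_periods[of f]
  have stab: "s \<in> ?D" if "s \<in> stabilizer I" for s
    using f(3) shift_invariant_imp_period that by blast
  \<comment> \<open>Otherwise \<open>f\<close> would be a nonzero constant in
    \<open>I\<close>.\<close>
  have not_all: "\<not> \<Omega> \<subseteq> ?D"
  proof
    assume "\<Omega> \<subseteq> ?D"
    then have "x \<in> ?D" for x
      using complex.span_minimal[OF _ D] span by blast
    then have "eval f x = eval f 0" for x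
      using complex.scale_one[of x]
      unfolding periods_def by (metis (mono_tags, lifting) add_0 mem_Collect_eq)
    then have "f = const_polynomial (eval f 0)"
      by (intro polynomial_eqI) simp
    moreover have "eval f 0 \<noteq> 0"
      using calculation f(2) by (metis eval_simps(1) const_polynomial.rep_eq polynomial_eqI)
    ultimately show False
      using const_not_mem f(1) by metis
  qed
  have divide: "v \<in> ?D" if "of_int k *\<^sub>C v \<in> ?D" "k \<noteq> 0" for k :: int and v
    using complex.subspace_scale[OF D that(1), of "1 / of_int k"] that(2) by simp
  \<comment> \<open>If every element of \<Omega> were torsion, all of \<Omega> would consist of
    periods.\<close>
  obtain \<nu> where \<nu>: "\<nu> \<in> \<Omega>" "\<not> torsion \<nu>"
    using not_all stab divide unfolding torsion_def by blast
  obtain i where "shift_polynomial (0 + of_nat i *\<^sub>C \<nu>) (B \<nu>) \<in> I"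
    using torsion_or_escape[OF \<mu>(1) \<nu>(1) _ \<nu>(2), of 0] \<mu>(2) by auto
  then have rel: "\<exists>j k :: int. k \<noteq> 0 \<and> of_int j *\<^sub>C \<nu> + of_int k *\<^sub>C v \<in> ?D" if "v \<in> \<Omega>" for v
    using stabilizer_relation[OF \<nu> _ that] stab by blast
  \<comment> \<open>Periods may exceed the stabilizer, so non-torsion alone is not enough: if \<nu>
    were a period, the relations would make all of \<Omega> periods.\<close>
  have \<nu>_D: "\<nu> \<notin> ?D"
  proof
    assume "\<nu> \<in> ?D"
    have "v \<in> ?D" if v: "v \<in> \<Omega>" for v
    proof -
      obtain j k :: int where "k \<noteq> 0" "of_int j *\<^sub>C \<nu> + of_int k *\<^sub>C v \<in> ?D"
        using rel[OF v] by blast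
      moreover from complex.subspace_diff[OF D this(2) complex.subspace_scale[OF D \<open>\<nu> \<in> ?D\<close>], of "of_int j"]
      have "of_int k *\<^sub>C v \<in> ?D" by simp
      ultimately show ?thesis using divide by blast
    qed
    then show False using not_all by blast
  qed
  have rational: "\<exists>j k :: int. k \<noteq> 0 \<and> v - (of_int j / of_int k) *\<^sub>C \<nu> \<in> ?D" if "v \<in> \<Omega>" for v
  proof -
    obtain j k :: int where k: "k \<noteq> 0" "of_int j *\<^sub>C \<nu> + of_int k *\<^sub>C v \<in> ?D"
      using rel \<open>v \<in> \<Omega>\<close> by blast
    have "v - (of_int (- j) / of_int k) *\<^sub>C \<nu> = (1 / of_int k) *\<^sub>C (of_int j *\<^sub>C \<nu> + of_int k *\<^sub>C v)"
      using k(1) by (simp add: complex.scale_right_distrib add.commute)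
    then show ?thesis
      using k complex.subspace_scale[OF D k(2), of "1 / of_int k"] by metis
  qed
  \<comment> \<open>The vectors that have a coordinate along \<nu> modulo the periods form a
    subspace containing \<Omega>, hence fill the space.\<close>
  have "complex.subspace {x. \<exists>z. x - z *\<^sub>C \<nu> \<in> ?D}" (is "complex.subspace ?T")
  proof (rule complex.subspaceI)
    have "0 - 0 *\<^sub>C \<nu> \<in> ?D"
      using complex.subspace_0[OF D] by simp
    then show "0 \<in> ?T" by blast
  next
    fix x y assume "x \<in> ?T" "y \<in> ?T"
    then obtain z w where "x - z *\<^sub>C \<nu> \<in> ?D" "y - w *\<^sub>C \<nu> \<in> ?D" by blast
    from complex.subspace_add[OF D this] have "(x + y) - (z + w) *\<^sub>C \<nu> \<in> ?D"
      by (simp add: complex.scale_left_distrib algebra_simps)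
    then show "x + y \<in> ?T" by blast
  next
    fix c x assume "x \<in> ?T"
    then obtain z where "x - z *\<^sub>C \<nu> \<in> ?D" by blast
    from complex.subspace_scale[OF D this, of c] have "c *\<^sub>C x - (c * z) *\<^sub>C \<nu> \<in> ?D"
      by (simp add: complex.scale_right_diff_distrib)
    then show "c *\<^sub>C x \<in> ?T" by blast
  qed
  moreover have "\<Omega> \<subseteq> ?T"
    using rational by blast
  ultimately have "?T = UNIV"
    using complex.span_minimal[of \<Omega> ?T] span by blast
  then have "\<exists>z. x - z *\<^sub>C \<nu> \<in> ?D" for x
    by (simp add: set_eq_iff)
  then obtain \<alpha> where \<alpha>: "linear_functional \<alpha>" "\<And>x z. x - z *\<^sub>C \<nu> \<in> ?D \<longleftrightarrow> z = \<alpha> x"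
    using complementary_functional[OF D \<nu>_D] by blast
  have \<alpha>\<nu>: "\<alpha> \<nu> = 1"
    using \<alpha>(2)[of \<nu> 1] complex.subspace_0[OF D] by simp
  have "\<exists>k::int. k \<noteq> 0 \<and> of_int k * \<alpha> s \<in> \<int>" if "s \<in> S" for s
  proof -
    have "s \<in> \<Omega>"
      using that gens(2) monoid_closure.base by blast
    then obtain j k :: int where "k \<noteq> 0" "of_int j / of_int k = \<alpha> s"
      using rational \<alpha>(2) by blast
    then have "k \<noteq> 0 \<and> of_int k * \<alpha> s = of_int j"
      by (auto simp: field_simps)
    then show ?thesis
      by (metis Ints_of_int)
  qed
  \<comment> \<open>Finite generation of \<Omega> enters here: one integer clears the denominators
    of \<alpha> on all generators.\<close>
  then obtain M :: int where M: "M \<noteq> 0" "\<And>s. s \<in> S \<Longrightarrow> of_int M * \<alpha> s \<in> \<int>"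
    using common_denominator[OF gens(1), of \<alpha>] by blast
  define \<beta> where "\<beta> x = of_int M * \<alpha> x" for x
  have lin: "linear_functional \<beta>"
    unfolding \<beta>_def using \<alpha>(1) by (rule linear_functional_mult_left)
  have int: "\<beta> \<in> integral_functionals (group_closure \<Omega>)"
    using lin M(2) Ints_on_group_closure[OF lin, of S] unfolding gens(2)
    by (intro integral_functionalI) (auto simp: \<beta>_def)
  \<comment> \<open>The restriction of \<open>f\<close> to the line through \<nu>; it determines
    \<open>f\<close>, since x - \<alpha>(x) \<nu> is a period.\<close>
  let ?p = "eval_coeffs (taylor \<nu> f) 0"
  have fp: "eval f x = poly ?p (\<alpha> x)" for x
  proof -
    have "x - \<alpha> x *\<^sub>C \<nu> \<in> ?D"
      using \<alpha>(2) by blast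
    then have "eval f (\<alpha> x *\<^sub>C \<nu> + 1 *\<^sub>C (x - \<alpha> x *\<^sub>C \<nu>)) = eval f (\<alpha> x *\<^sub>C \<nu>)"
      unfolding periods_def by blast
    then show ?thesis
      by (simp add: poly_taylor)
  qed
  have "?p \<noteq> 0"
  proof
    assume "?p = 0"
    then have "f = 0"
      using fp by (intro polynomial_eqI) simp
    then show False using f(2) by simp
  qed
  then obtain r where r: "Polynomial \<alpha> - const_polynomial r \<in> I"
    using linear_factor_mem[OF \<alpha>(1) f(1) _ fp] by blast
  let ?h = "Polynomial \<beta> + const_polynomial (- of_int M * r)"
  have "?h = (Polynomial \<alpha> - const_polynomial r) * const_polynomial (of_int M)"
    using lin \<alpha>(1) by (intro polynomial_eqI) (simp add: \<beta>_def algebra_simps)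
  then have "?h \<in> I"
    using mult_mem[OF r] by simp
  moreover have "?h \<noteq> 0"
  proof
    assume "?h = 0"
    then have "eval ?h \<nu> = eval ?h 0"
      by simp
    then show False
      using lin M(1) by (simp add: \<alpha>\<nu> \<beta>_def linear_functional_zero[OF \<alpha>(1)])
  qed
  ultimately show ?thesis
    using int by blast
qed

section \<open>Extracting linear factors\<close>

text \<open>The expansion of \<open>h\<close> is linear in t, hence associated to \<open>P\<close>
  and a divisor of the expansion of \<open>g\<close> over the field of rational functions. Its root
  is itself a polynomial, so evaluation there brings divisibility back to polynomials.\<close>

lemma affine_dvd:
  assumes P: "irreducible P" and \<alpha>: "linear_functional \<alpha>"
    and h: "h = Polynomial \<alpha> + const_polynomial k" "h \<noteq> 0"
    and Ph: "P dvd fract_poly (taylor e h)" and Pg: "P dvd fract_poly (taylor e g)"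
  shows "h dvd g"
proof -
  have th: "taylor e h = [:h, const_polynomial (\<alpha> e):]"
    unfolding h(1) using \<alpha> by (rule taylor_affine)
  \<comment> \<open>Otherwise the expansion of \<open>h\<close> would be a nonzero constant in t, a
    unit that \<open>P\<close> cannot divide.\<close>
  have "\<alpha> e \<noteq> 0"
  proof
    assume "\<alpha> e = 0"
    moreover have "const_polynomial 0 = (0 :: 'a polynomial)"
      by (rule polynomial_eqI) simp
    ultimately have "P dvd [:to_fract h:]"
      using Ph th by (simp add: map_poly_pCons)
    moreover have "[:to_fract h:] dvd 1"
      using h(2) by (simp add: is_unit_const_poly_iff dvd_field_iff)
    ultimately show False
      using P dvd_trans unfolding irreducible_def by blast
  qed
  \<comment> \<open>The point x + u(x) e is the projection of x along e onto the zero set of h; as g vanishes there,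
    the expansion of g along e at t = u shows that u divides g.\<close>
  define u where "u = const_polynomial (- 1 / \<alpha> e) * h"
  have cu: "h + const_polynomial (\<alpha> e) * u = 0"
    using \<open>\<alpha> e \<noteq> 0\<close> by (intro polynomial_eqI) (simp add: u_def)
  have c0: "const_polynomial (\<alpha> e) \<noteq> (0 :: 'a polynomial)"
    using \<open>\<alpha> e \<noteq> 0\<close> by (metis eval_simps(1) const_polynomial.rep_eq)
  have "irreducible (fract_poly (taylor e h))"
    unfolding th using c0 by (simp add: map_poly_pCons irreducible_linear_field_poly)
  then have "fract_poly (taylor e h) dvd fract_poly (taylor e g)"
    using irreducible_dvd_imp_dvd[OF P _ Ph] Pg dvd_trans by blast
  then obtain F where F: "fract_poly (taylor e g) = fract_poly (taylor e h) * F" ..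
  have root: "poly (fract_poly F) (to_fract u) = to_fract (poly F u)" for F
    by (induction F) (simp_all add: map_poly_pCons)
  have "poly (taylor e h) u = 0"
    using cu by (simp add: th mult.commute)
  then have "to_fract (poly (taylor e g) u) = 0"
    by (simp add: F flip: root) (simp add: root)
  then have "poly (taylor e g) u = 0"
    by simp
  \<comment> \<open>With constant term \<open>g\<close>, vanishing at \<open>u\<close> reads g + u
    G(u) = 0, and \<open>u\<close> is a multiple of \<open>h\<close>.\<close>
  moreover obtain G where "taylor e g = pCons g G"
    by (metis coeff_0_taylor coeff_pCons_0 pCons_cases)
  ultimately have "g = h * (- const_polynomial (- 1 / \<alpha> e) * poly G u)"
    by (simp add: u_def algebra_simps eq_neg_iff_add_eq_0)
  then show ?thesis
    by (rule dvdI)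
qed

lemma irreducible_divisor_exists:
  fixes p :: "'k::field poly"
  assumes "degree p > 0"
  shows "\<exists>q. irreducible q \<and> q dvd p"
  using assms
proof (induction "degree p" arbitrary: p rule: less_induct)
  case less
  show ?case
  proof (cases "irreducible p")
    case False
    have "p \<noteq> 0"
      using less.prems by auto
    moreover from this have "\<not> p dvd 1"
      using less.prems by (simp add: is_unit_iff_degree)
    ultimately obtain a b where ab: "p = a * b" "\<not> a dvd 1" "\<not> b dvd 1"
      using False unfolding irreducible_def by blast
    then have "a \<noteq> 0" "b \<noteq> 0"
      using less.prems by auto
    then have "degree a > 0" "degree b > 0" "degree p = degree a + degree b"
      using ab by (simp_all add: is_unit_iff_degree degree_mult_eq)
    then have "\<exists>q. irreducible q \<and> q dvd a"
      using less.hyps[of a] by simp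
    then show ?thesis
      using ab(1) by (meson dvd_mult2)
  qed auto
qed

section \<open>Induction on divisors by splitting off integral affine factors\<close>

definition affine_product :: "'a::complex_space set \<Rightarrow> 'a polynomial \<Rightarrow> bool" where
  "affine_product L p \<longleftrightarrow> (\<exists>(n::nat) \<alpha> k. (\<forall>i<n. \<alpha> i \<in> integral_functionals L) \<and>
     (\<forall>x. eval p x = (\<Prod>i<n. \<alpha> i x + k i)))"

text \<open>One factor with the zero functional.\<close>

lemma affine_product_const: "affine_product L (const_polynomial c)"
  unfolding affine_product_def
  by (intro exI[of _ 1] exI[of _ "\<lambda>_ _. 0"] exI[of _ "\<lambda>_. c"])
    (simp add: zero_integral_functional)

lemma affine_product_mult:
  assumes "\<alpha> \<in> integral_functionals L" "affine_product L p"
  shows "affine_product L ((Polynomial \<alpha> + const_polynomial k) * p)"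
proof -
  obtain n :: nat and A K where A: "\<And>i. i < n \<Longrightarrow> A i \<in> integral_functionals L"
    and p: "\<And>x. eval p x = (\<Prod>i<n. A i x + K i)"
    using assms(2) unfolding affine_product_def by blast
  have "linear_functional \<alpha>"
    using assms(1) by (simp add: integral_functionals_def)
  then have "eval ((Polynomial \<alpha> + const_polynomial k) * p) x =
      (\<Prod>i<Suc n. (A(n := \<alpha>)) i x + (K(n := k)) i)" for x
    by (simp add: p mult.commute)
  moreover have "\<forall>i<Suc n. (A(n := \<alpha>)) i \<in> integral_functionals L"
    using A assms(1) by (simp add: less_Suc_eq)
  ultimately show ?thesis
    unfolding affine_product_def by blast
qed

lemma constant_if_degrees_0:
  assumes "complex.span E = UNIV" "\<And>e. e \<in> E \<Longrightarrow> degree (taylor e g) = 0"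
  shows "g = const_polynomial (eval g 0)"
proof (rule polynomial_eqI)
  fix x
  have "E \<subseteq> periods g"
    using taylor_degree_0[OF assms(2)] unfolding periods_def by blast
  then have "x \<in> periods g"
    using complex.span_minimal[OF _ subspace_periods] assms(1) by blast
  then have "eval g (0 + 1 *\<^sub>C x) = eval g 0"
    unfolding periods_def by blast
  then show "eval g x = eval (const_polynomial (eval g 0)) x"
    by simp
qed

text \<open>Stated for all divisors of \<open>B \<mu>\<close>, so that the quotient by a split-off
  factor falls under the induction hypothesis. The measure adds the degrees along a finite spanning
  set; it is additive on products and vanishes only on constants.\<close>

lemma (in polynomial_cocycle) affine_product_divisor:
  assumes gens: "finite S" "\<Omega> = monoid_closure S" and span: "complex.span \<Omega> = UNIV"
    and E: "finite (E :: 'v set)" "complex.span E = UNIV"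
    and \<mu>: "\<mu> \<in> \<Omega>" and g: "g dvd B \<mu>"
  shows "affine_product (group_closure \<Omega>) g"
  using g
proof (induction "\<Sum>e\<in>E. degree (taylor e g)" arbitrary: g rule: less_induct)
  case less
  have "g \<noteq> 0"
    using less.prems nonzero[OF \<mu>] by auto
  show ?case
  proof (cases "\<forall>e\<in>E. degree (taylor e g) = 0")
    case True
    then show ?thesis
      using constant_if_degrees_0[OF E(2)] affine_product_const by metis
  next
    case False
    then obtain e where "degree (fract_poly (taylor e g)) > 0"
      by (auto simp: degree_map_poly)
    then obtain P where P: "irreducible P" "P dvd fract_poly (taylor e g)"
      using irreducible_divisor_exists by blast
    let ?I = "{f. P dvd fract_poly (taylor e f)}"
    interpret cocycle_prime \<Omega> B ?I
      by (intro cocycle_prime.intro polynomial_cocycle_axioms shift_finite_prime_irreducible P(1))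
    have "B \<mu> \<in> ?I"
      using P(2) less.prems by (auto simp: taylor_mult)
    then obtain \<alpha> k where \<alpha>: "\<alpha> \<in> integral_functionals (group_closure \<Omega>)"
      and h: "Polynomial \<alpha> + const_polynomial k \<in> ?I" "Polynomial \<alpha> + const_polynomial k \<noteq> 0"
      using integral_affine_member[OF gens span \<mu>] by blast
    define h where "h = Polynomial \<alpha> + const_polynomial k"
    have lin: "linear_functional \<alpha>"
      using \<alpha> by (simp add: integral_functionals_def)
    have "h dvd g"
      using affine_dvd[OF P(1) lin h_def _ _ P(2)] h by (simp add: h_def)
    then obtain q where q: "g = h * q" ..
    then have "h \<noteq> 0" "q \<noteq> 0"
      using \<open>g \<noteq> 0\<close> by auto
    have deg: "degree (taylor e g) = degree (taylor e h) + degree (taylor e q)" for e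
      using q \<open>h \<noteq> 0\<close> \<open>q \<noteq> 0\<close> by (simp add: degree_taylor_mult)
    \<comment> \<open>The measure drops because \<open>h\<close> is not constant: it is a nonzero
      element of the prime ideal, which contains no unit.\<close>
    have "\<exists>e\<in>E. degree (taylor e h) > 0"
    proof (rule ccontr)
      assume "\<not> ?thesis"
      then have const: "h = const_polynomial (eval h 0)"
        using constant_if_degrees_0[OF E(2), of h] by (metis gr0I)
      then have "eval h 0 \<noteq> 0"
        using \<open>h \<noteq> 0\<close> by (metis eval_simps(1) const_polynomial.rep_eq polynomial_eqI)
      then show False
        using const_not_mem const h(1) h_def by metis
    qed
    then have "(\<Sum>e\<in>E. degree (taylor e q)) < (\<Sum>e\<in>E. degree (taylor e g))"
      using E(1) deg by (intro sum_strict_mono_ex1) auto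
    moreover have "q dvd B \<mu>"
      using q less.prems by (meson dvd_mult_right)
    ultimately have "affine_product (group_closure \<Omega>) q"
      by (rule less.hyps)
    then show ?thesis
      using affine_product_mult[OF \<alpha>] q h_def by simp
  qed
qed

theorem lemma6:
  fixes \<Lambda> \<Omega> :: "'v::complex_space set"
    and b :: "'v \<Rightarrow> 'v rational_function"
  assumes "lattice \<Lambda>"
    and "fin_gen_submonoid \<Omega>" and "\<Omega> \<subseteq> \<Lambda>" and "group_closure \<Omega> = \<Lambda>"
    and "\<And>\<mu>. \<mu> \<in> \<Lambda> \<Longrightarrow> b \<mu> \<noteq> 0"
    and "\<And>\<mu> \<nu>. \<mu> \<in> \<Lambda> \<Longrightarrow> \<nu> \<in> \<Lambda> \<Longrightarrow> b \<mu> * shift \<mu> (b \<nu>) = b (\<mu> + \<nu>)"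
    and "\<And>\<mu>. \<mu> \<in> \<Omega> \<Longrightarrow> b \<mu> \<in> range rational_of_polynomial"
  shows "\<forall>\<mu>\<in>\<Omega>. \<exists>(n::nat) (\<alpha> :: nat \<Rightarrow> 'v \<Rightarrow> complex) (k :: nat \<Rightarrow> complex) (p :: 'v polynomial).
           (\<forall>i<n. \<alpha> i \<in> integral_functionals \<Lambda>) \<and>
           b \<mu> = rational_of_polynomial p \<and>
           (\<forall>x. eval p x = (\<Prod>i<n. \<alpha> i x + k i))"
proof
  fix \<mu> assume \<mu>: "\<mu> \<in> \<Omega>"
  obtain S where S: "finite S" "\<Omega> = monoid_closure S"
    using assms(2) unfolding fin_gen_submonoid_def by blast
  obtain E where E: "finite_dimensional_vector_space scaleC E" "\<Lambda> = group_closure E"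
    using assms(1) unfolding lattice_def by blast
  interpret E: finite_dimensional_vector_space scaleC E
    by (rule E(1))
  \<comment> \<open>Since \<Omega> generates \<Lambda> as a group and \<Lambda> contains a complex
    basis, \<Omega> spans the space.\<close>
  have "\<Lambda> \<subseteq> complex.span \<Omega>"
  proof
    fix x assume "x \<in> \<Lambda>"
    then have "x \<in> group_closure \<Omega>" using assms(4) by simp
    then show "x \<in> complex.span \<Omega>"
      by induction (auto intro: complex.span_base complex.span_zero complex.span_diff)
  qed
  moreover have "E \<subseteq> \<Lambda>"
    unfolding E(2) by (auto intro: group_closure.base)
  ultimately have span: "complex.span \<Omega> = UNIV"
    using E.span_Basis complex.span_minimal[OF _ complex.subspace_span, of E \<Omega>] by auto
  \<comment> \<open>Outside \<Omega> the values of \<open>B\<close> are arbitrary.\<close>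
  obtain B where B: "\<And>\<mu>. \<mu> \<in> \<Omega> \<Longrightarrow> b \<mu> = to_fract (B \<mu>)"
    using assms(7) unfolding rational_of_polynomial_eq_to_fract image_iff by metis
  interpret polynomial_cocycle \<Omega> B
  proof
    show "0 \<in> \<Omega>"
      unfolding S(2) by (rule monoid_closure.zero)
    show add: "\<mu> + \<nu> \<in> \<Omega>" if "\<mu> \<in> \<Omega>" "\<nu> \<in> \<Omega>" for \<mu> \<nu>
      using that unfolding S(2) by (rule monoid_closure.add)
    show "B \<mu> \<noteq> 0" if "\<mu> \<in> \<Omega>" for \<mu>
      using assms(3,5) B[OF that] that by fastforce
    show "B \<mu> * shift_polynomial \<mu> (B \<nu>) = B (\<mu> + \<nu>)" if "\<mu> \<in> \<Omega>" "\<nu> \<in> \<Omega>" for \<mu> \<nu>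
    proof -
      have "b \<mu> * shift \<mu> (b \<nu>) = b (\<mu> + \<nu>)"
        using that assms(3,6) by blast
      then show ?thesis
        by (simp add: B add that shift_to_fract flip: to_fract_mult)
    qed
  qed
  have "affine_product \<Lambda> (B \<mu>)"
    using affine_product_divisor[OF S span E.finite_Basis E.span_Basis \<mu> dvd_refl] assms(4) by simp
  then show "\<exists>(n::nat) (\<alpha> :: nat \<Rightarrow> 'v \<Rightarrow> complex) (k :: nat \<Rightarrow> complex) (p :: 'v polynomial).
           (\<forall>i<n. \<alpha> i \<in> integral_functionals \<Lambda>) \<and>
           b \<mu> = rational_of_polynomial p \<and>
           (\<forall>x. eval p x = (\<Prod>i<n. \<alpha> i x + k i))"
    using B[OF \<mu>] unfolding affine_product_def rational_of_polynomial_eq_to_fract by blast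
qed

end
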